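(* Let $\sigma\ge 0.5$. Then for every $\tau>0$ the difference scheme $$B\frac{y^{n+1}-y^n}{\tau}+Ay^n=\varphi^n,\quad n=0,1,\dots,N_0-1,\qquad y^0=u^0,$$ with $B=E+\sigma\tau A$, $A=A^n=C_0^n+D$ (equivalently $\frac{y^{n+1}-y^n}\tau+(C_0^n+D)(\sigma y^{n+1}+(1-\sigma)y^n)=\varphi^n$) is stable (i.e. it is unconditionally stable), and its solution satisfies the a priori estimate $$\|y^{n+1}\|^2\le\|u^0\|^2+\frac12\sum_{k=0}^n\tau\|\varphi^k\|_{D^{-1}}^2,\qquad n=0,1,\dots,N_0-1 .$$
   Context: $H$ is a finite-dimensional real Hilbert space (of grid functions) with scalar product $(\cdot,\cdot)$ and norm $\|\cdot\|$; $E$ is the identity. $\tau>0$ is the time step, $N_0\tau=T$, $t^n=n\tau$. $D$ is a linear operator on $H$, independent of time, with $D=D^*\ge\frac{\kappa_1}{M_0}E$, $\kappa_1,M_0>0$. $C_0^n$ is a (possibly time-dependent) skew-symmetric operator, $(C_0^n)^*=-C_0^n$ (the discrete convection operator in skew-symmetric form taken e.g. at time $\frac12(t^n+t^{n+1})$). $u^0,\varphi^n\in H$ are given and $\|\varphi\|_{D^{-1}}^2=(D^{-1}\varphi,\varphi)$. *)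

theory Defs
  imports "HOL-Analysis.Analysis"
begin

text \<open>Order on operators: \<open>R \<ge> S\<close> means \<open>(R x, x) \<ge> (S x, x)\<close> for all \<open>x\<close>.\<close>

definition op_ge :: "('a::real_inner \<Rightarrow> 'a) \<Rightarrow> ('a \<Rightarrow> 'a) \<Rightarrow> bool" where
  "op_ge R S \<longleftrightarrow> (\<forall>x. R x \<bullet> x \<ge> S x \<bullet> x)"

definition energy_norm :: "('a::real_inner \<Rightarrow> 'a) \<Rightarrow> 'a \<Rightarrow> real" where
  "energy_norm R x = sqrt (R x \<bullet> x)"

text \<open>Only \<open>y 0, \<dots>, y N\<close> are constrained, and only
  \<open>B n, A n, \<phi> n\<close> with \<open>n < N\<close> are used.\<close>

definition scheme_solution ::
  "real \<Rightarrow> nat \<Rightarrow> (nat \<Rightarrow> 'a::real_vector \<Rightarrow> 'a) \<Rightarrow> (nat \<Rightarrow> 'a \<Rightarrow> 'a)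
    \<Rightarrow> (nat \<Rightarrow> 'a) \<Rightarrow> 'a \<Rightarrow> (nat \<Rightarrow> 'a) \<Rightarrow> bool" where
  "scheme_solution \<tau> N B A \<phi> u0 y \<longleftrightarrow>
     y 0 = u0 \<and>
     (\<forall>n<N. B n ((1 / \<tau>) *\<^sub>R (y (Suc n) - y n)) + A n (y n) = \<phi> n)"

definition uniquely_solvable ::
  "real \<Rightarrow> nat \<Rightarrow> (nat \<Rightarrow> 'a::real_vector \<Rightarrow> 'a) \<Rightarrow> (nat \<Rightarrow> 'a \<Rightarrow> 'a) \<Rightarrow> bool" where
  "uniquely_solvable \<tau> N B A \<longleftrightarrow>
     (\<forall>\<phi> u0. (\<exists>y. scheme_solution \<tau> N B A \<phi> u0 y) \<and>
        (\<forall>y z. scheme_solution \<tau> N B A \<phi> u0 y \<longrightarrow> scheme_solution \<tau> N B A \<phi> u0 z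
           \<longrightarrow> (\<forall>n\<le>N. y n = z n)))"

text \<open>Stability with respect to the initial data and the right-hand side, the latter measured
  in \<open>rnorm\<close>, on the time interval \<open>[0, T]\<close>.  The operators of the scheme may depend on the
  time step \<open>\<tau>\<close>.  The constants \<open>m1\<close>, \<open>m2\<close> depend neither on \<open>\<tau>\<close> nor on the data, and \<open>\<tau>\<close> is
  subject to no restriction besides dividing \<open>T\<close>.\<close>

definition unconditionally_stable ::
  "('a::real_normed_vector \<Rightarrow> real) \<Rightarrow> real \<Rightarrow> (real \<Rightarrow> nat \<Rightarrow> 'a \<Rightarrow> 'a)
    \<Rightarrow> (real \<Rightarrow> nat \<Rightarrow> 'a \<Rightarrow> 'a) \<Rightarrow> bool" where
  "unconditionally_stable rnorm T B A \<longleftrightarrow>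
     (\<exists>m1>0. \<exists>m2>0. \<forall>\<tau>>0. \<forall>N. real N * \<tau> = T \<longrightarrow>
        (\<forall>\<phi> u0 y. scheme_solution \<tau> N (B \<tau>) (A \<tau>) \<phi> u0 y \<longrightarrow>
           (\<forall>n<N. norm (y (Suc n)) \<le> m1 * norm u0 + m2 * (MAX k\<in>{..n}. rnorm (\<phi> k)))))"

definition conv_diff_op ::
  "(real \<Rightarrow> nat \<Rightarrow> 'a::real_vector \<Rightarrow> 'a) \<Rightarrow> ('a \<Rightarrow> 'a) \<Rightarrow> real \<Rightarrow> nat \<Rightarrow> 'a \<Rightarrow> 'a" where
  "conv_diff_op C0 D \<tau> n x = C0 \<tau> n x + D x"

text \<open>The operator \<open>B = E + \<sigma> \<tau> A\<close>.\<close>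

definition weighted_op ::
  "real \<Rightarrow> (real \<Rightarrow> nat \<Rightarrow> 'a::real_vector \<Rightarrow> 'a) \<Rightarrow> real \<Rightarrow> nat \<Rightarrow> 'a \<Rightarrow> 'a" where
  "weighted_op \<sigma> A \<tau> n x = x + (\<sigma> * \<tau>) *\<^sub>R A \<tau> n x"

end

theory Submission imports Defs begin

text \<open>With \<open>w = \<sigma> y' + (1 - \<sigma>) y\<close> one has
  \<open>2 (y' - y, w) = \<parallel>y'\<parallel>\<^sup>2 - \<parallel>y\<parallel>\<^sup>2 + (2 \<sigma> - 1) \<parallel>y' - y\<parallel>\<^sup>2\<close>.
  Pairing the scheme with \<open>w\<close> eliminates the skew-symmetric part, and
  \<open>(\<phi>, w) \<le> (D w, w) + 1/4 (D\<^sup>-\<^sup>1 \<phi>, \<phi>)\<close>, so the dissipation absorbs the source term and each step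
  increases \<open>\<parallel>y\<parallel>\<^sup>2\<close> by at most \<open>\<tau>/2 (D\<^sup>-\<^sup>1 \<phi>, \<phi>)\<close>.  The same pairing shows that \<open>E + \<sigma> \<tau> A\<close> has
  trivial kernel, which gives solvability in finite dimension.\<close>

text \<open>Definiteness leaves only the zero vector in the kernel, and an injective endomorphism of
  a finite-dimensional space is onto. Applied to \<open>D\<close> it makes \<open>inv D\<close> a
  genuine inverse; applied to E + \<sigma> \<tau> A it lets the scheme be solved for the next
  layer.\<close>

lemma linear_bij_if_definite:
  fixes f :: "'a::euclidean_space \<Rightarrow> 'a"
  assumes "linear f" and "\<And>x. x \<noteq> 0 \<Longrightarrow> f x \<bullet> x > 0"
  shows "bij f"
proof -
  have "inj f"
    unfolding linear_injective_0[OF assms(1)]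
    using assms(2) by (metis inner_zero_left less_irrefl)
  then show ?thesis
    using linear_injective_imp_surjective[OF assms(1)] by (simp add: bij_def)
qed

lemma self_adjoint_inner_commute:
  fixes D :: "'a::euclidean_space \<Rightarrow> 'a"
  assumes "linear D" and "adjoint D = D"
  shows "D x \<bullet> y = x \<bullet> D y"
  using adjoint_works[OF assms(1), of x y] assms(2) by simp

lemma skew_adjoint_inner_eq_0:
  fixes C :: "'a::euclidean_space \<Rightarrow> 'a"
  assumes "linear C" and "adjoint C = (\<lambda>x. - C x)"
  shows "C x \<bullet> x = 0"
proof -
  have "x \<bullet> (- C x) = C x \<bullet> x"
    using adjoint_works[OF assms(1), of x x] assms(2) by (simp add: inner_commute)
  then show ?thesis by (simp add: inner_commute)
qed

text \<open>Completing the square in the energy of \<open>D\<close>: the form is nonnegative at w -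
  g/2, where D g = p. The cross term is then exactly (p, w), and the remainder is a quarter of (D g,
  g) = (p, g).\<close>

lemma inner_le_energy:
  fixes D :: "'a::euclidean_space \<Rightarrow> 'a"
  assumes lin: "linear D" and adj: "adjoint D = D" and pos: "\<And>x. x \<noteq> 0 \<Longrightarrow> D x \<bullet> x > 0"
  shows "p \<bullet> w \<le> D w \<bullet> w + 1 / 4 * (energy_norm (inv D) p)\<^sup>2"
proof -
  define g where "g = inv D p"
  have p: "p = D g"
    using linear_bij_if_definite[OF lin pos] by (simp add: g_def bij_is_surj surj_f_inv_f)
  have nonneg: "0 \<le> D x \<bullet> x" for x
    using pos[of x] lin by (cases "x = 0") (auto simp: linear_0)
  have sq: "(energy_norm (inv D) p)\<^sup>2 = D g \<bullet> g"
    unfolding energy_norm_def g_def[symmetric] using nonneg[of g]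
    by (simp add: p inner_commute[of _ g])
  have "0 \<le> D (w - (1/2) *\<^sub>R g) \<bullet> (w - (1/2) *\<^sub>R g)"
    by (rule nonneg)
  also have "\<dots> = D w \<bullet> w - 1/2 * (D w \<bullet> g) - 1/2 * (D g \<bullet> w) + 1/4 * (D g \<bullet> g)"
    by (simp add: linear_diff[OF lin] linear_scale[OF lin] inner_simps
        inner_commute[of w] inner_commute[of g] algebra_simps)
  \<comment> \<open>Self-adjointness merges the two halves of the cross term.\<close>
  also have "D w \<bullet> g = D g \<bullet> w"
    using self_adjoint_inner_commute[OF lin adj, of w g] by (simp add: inner_commute)
  finally show ?thesis unfolding sq by (simp add: p)
qed

text \<open>Write the average as (v + u)/2 + (\<sigma> - 1/2)(v - u): the midpoint produces the
  difference of squares, the deviation from it the last term.\<close>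

lemma weighted_average_inner:
  fixes u v :: "'a::real_inner"
  shows "2 * ((v - u) \<bullet> (\<sigma> *\<^sub>R v + (1 - \<sigma>) *\<^sub>R u))
    = (norm v)\<^sup>2 - (norm u)\<^sup>2 + (2 * \<sigma> - 1) * (norm (v - u))\<^sup>2"
  unfolding power2_norm_eq_inner by (simp add: inner_simps inner_commute[of u v]
      left_diff_distrib right_diff_distrib distrib_left distrib_right)

lemma weighted_scheme_step_bound:
  fixes D A :: "'a::euclidean_space \<Rightarrow> 'a"
  assumes "linear D" "adjoint D = D" "\<And>x. x \<noteq> 0 \<Longrightarrow> D x \<bullet> x > 0"
    and A: "\<And>x. A x \<bullet> x = D x \<bullet> x"
    and "\<tau> > 0" "\<sigma> \<ge> 1 / 2"
    and step: "(1 / \<tau>) *\<^sub>R (v - u) + A (\<sigma> *\<^sub>R v + (1 - \<sigma>) *\<^sub>R u) = p"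
  shows "(norm v)\<^sup>2 \<le> (norm u)\<^sup>2 + 1 / 2 * (\<tau> * (energy_norm (inv D) p)\<^sup>2)"
proof -
  define w where "w = \<sigma> *\<^sub>R v + (1 - \<sigma>) *\<^sub>R u"
  have "p \<bullet> w = (1 / \<tau>) * ((v - u) \<bullet> w) + D w \<bullet> w"
    unfolding step[symmetric] w_def[symmetric] by (simp add: inner_add_left A)
  then have "(1 / \<tau>) * ((v - u) \<bullet> w) \<le> 1 / 4 * (energy_norm (inv D) p)\<^sup>2"
    using inner_le_energy[OF assms(1-3), of p w] by linarith
  then have "(v - u) \<bullet> w \<le> \<tau> * (1 / 4 * (energy_norm (inv D) p)\<^sup>2)"
    using \<open>\<tau> > 0\<close> by (simp add: field_simps)
  moreover have "0 \<le> (2 * \<sigma> - 1) * (norm (v - u))\<^sup>2"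
    using \<open>\<sigma> \<ge> 1 / 2\<close> by simp
  ultimately show ?thesis
    using weighted_average_inner[of v u \<sigma>] unfolding w_def by linarith
qed

text \<open>In \<open>B\<close> the factor \<tau> cancels 1/\<tau>, leaving \<sigma> A(v - u) + A u,
  which linearity collects into A(\<sigma> v + (1 - \<sigma>) u).\<close>

lemma weighted_scheme_solution_iff:
  assumes "\<tau> \<noteq> 0" and lin: "\<And>n. n < N \<Longrightarrow> linear (A \<tau> n)"
  shows "scheme_solution \<tau> N (weighted_op \<sigma> A \<tau>) (A \<tau>) \<phi> u0 y \<longleftrightarrow>
    y 0 = u0 \<and>
    (\<forall>n<N. (1 / \<tau>) *\<^sub>R (y (Suc n) - y n) + A \<tau> n (\<sigma> *\<^sub>R y (Suc n) + (1 - \<sigma>) *\<^sub>R y n) = \<phi> n)"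
proof -
  have "weighted_op \<sigma> A \<tau> n ((1 / \<tau>) *\<^sub>R (v - u)) + A \<tau> n u
      = (1 / \<tau>) *\<^sub>R (v - u) + A \<tau> n (\<sigma> *\<^sub>R v + (1 - \<sigma>) *\<^sub>R u)" if "n < N" for n u v
    using \<open>\<tau> \<noteq> 0\<close> lin[OF that]
    by (simp add: weighted_op_def linear_add linear_diff linear_scale algebra_simps)
  then show ?thesis unfolding scheme_solution_def by simp
qed

lemma weighted_scheme_bound:
  fixes D :: "'a::euclidean_space \<Rightarrow> 'a"
  assumes "linear D" "adjoint D = D" "\<And>x. x \<noteq> 0 \<Longrightarrow> D x \<bullet> x > 0"
    and lin: "\<And>n. n < N \<Longrightarrow> linear (A \<tau> n)"
    and A: "\<And>n x. n < N \<Longrightarrow> A \<tau> n x \<bullet> x = D x \<bullet> x"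
    and "\<tau> > 0" "\<sigma> \<ge> 1 / 2"
    and sol: "scheme_solution \<tau> N (weighted_op \<sigma> A \<tau>) (A \<tau>) \<phi> u0 y"
    and "n < N"
  shows "(norm (y (Suc n)))\<^sup>2
    \<le> (norm u0)\<^sup>2 + 1 / 2 * (\<Sum>k = 0..n. \<tau> * (energy_norm (inv D) (\<phi> k))\<^sup>2)"
proof -
  have eqs: "y 0 = u0"
    "\<And>k. k < N \<Longrightarrow>
      (1 / \<tau>) *\<^sub>R (y (Suc k) - y k) + A \<tau> k (\<sigma> *\<^sub>R y (Suc k) + (1 - \<sigma>) *\<^sub>R y k) = \<phi> k"
    using sol lin \<open>\<tau> > 0\<close> by (simp_all add: weighted_scheme_solution_iff)
  have step: "(norm (y (Suc k)))\<^sup>2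
      \<le> (norm (y k))\<^sup>2 + 1 / 2 * (\<tau> * (energy_norm (inv D) (\<phi> k))\<^sup>2)" if "k < N" for k
    using weighted_scheme_step_bound[OF assms(1-3) A[OF that] \<open>\<tau> > 0\<close> \<open>\<sigma> \<ge> 1 / 2\<close> eqs(2)[OF that]] .
  show ?thesis
    using \<open>n < N\<close>
  proof (induction n)
    case 0
    then show ?case using step[of 0] eqs(1) by simp
  next
    case (Suc n)
    then show ?case using step[of "Suc n"] by (simp add: algebra_simps)
  qed
qed

lemma uniquely_solvable_if_bij:
  fixes A B :: "nat \<Rightarrow> 'a::real_vector \<Rightarrow> 'a"
  assumes "\<tau> \<noteq> 0" and bij: "\<And>n. n < N \<Longrightarrow> bij (B n)"
  shows "uniquely_solvable \<tau> N B A"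
  unfolding uniquely_solvable_def
proof (intro allI conjI impI)
  fix \<phi> :: "nat \<Rightarrow> 'a" and u0 :: 'a
  \<comment> \<open>Time marching: each layer is solved explicitly for the next. From index
    \<open>N\<close> on, \<open>inv (B n)\<close> may be arbitrary, but the scheme puts no condition
    there.\<close>
  define y where "y = rec_nat u0 (\<lambda>n u. u + \<tau> *\<^sub>R inv (B n) (\<phi> n - A n u))"
  have "B n ((1 / \<tau>) *\<^sub>R (y (Suc n) - y n)) + A n (y n) = \<phi> n" if "n < N" for n
    using \<open>\<tau> \<noteq> 0\<close> bij[OF that] by (simp add: y_def bij_is_surj surj_f_inv_f)
  then have "scheme_solution \<tau> N B A \<phi> u0 y"
    by (simp add: scheme_solution_def y_def)
  then show "\<exists>y. scheme_solution \<tau> N B A \<phi> u0 y" by blast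
next
  fix \<phi> :: "nat \<Rightarrow> 'a" and u0 :: 'a and y z n
  assume y: "scheme_solution \<tau> N B A \<phi> u0 y" and z: "scheme_solution \<tau> N B A \<phi> u0 z"
    and "n \<le> N"
  from \<open>n \<le> N\<close> show "y n = z n"
  proof (induction n)
    case 0
    then show ?case using y z by (simp add: scheme_solution_def)
  next
    case (Suc n)
    then have n: "n < N" and eq: "y n = z n" by auto
    have "B n ((1 / \<tau>) *\<^sub>R (y (Suc n) - y n)) = \<phi> n - A n (y n)"
      "B n ((1 / \<tau>) *\<^sub>R (z (Suc n) - z n)) = \<phi> n - A n (z n)"
      using y z n by (auto simp: scheme_solution_def algebra_simps)
    then have "(1 / \<tau>) *\<^sub>R (y (Suc n) - y n) = (1 / \<tau>) *\<^sub>R (z (Suc n) - z n)"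
      by (subst inj_eq[OF bij_is_inj[OF bij[OF n]], symmetric]) (simp only: eq)
    then show ?case using \<open>\<tau> \<noteq> 0\<close> eq by simp
  qed
qed

text \<open>Since (A x, x) is nonnegative, (B x, x) is at least (x, x) however large \<sigma> \<tau>
  is, so solvability puts no restriction on the time step.\<close>

lemma bij_weighted_op:
  fixes A :: "real \<Rightarrow> nat \<Rightarrow> 'a::euclidean_space \<Rightarrow> 'a"
  assumes lin: "linear (A \<tau> n)" and nonneg: "\<And>x. 0 \<le> A \<tau> n x \<bullet> x" and "0 \<le> \<sigma> * \<tau>"
  shows "bij (weighted_op \<sigma> A \<tau> n)"
proof (rule linear_bij_if_definite)
  show "linear (weighted_op \<sigma> A \<tau> n)"
    by (rule linearI)
      (simp_all add: weighted_op_def linear_add[OF lin] linear_scale[OF lin] algebra_simps)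
  fix x :: 'a assume "x \<noteq> 0"
  then have "0 < x \<bullet> x" by simp
  moreover have "0 \<le> \<sigma> * \<tau> * (A \<tau> n x \<bullet> x)"
    using nonneg[of x] \<open>0 \<le> \<sigma> * \<tau>\<close> by (rule mult_nonneg_nonneg[rotated])
  ultimately show "0 < weighted_op \<sigma> A \<tau> n x \<bullet> x"
    by (simp add: weighted_op_def inner_add_left add_pos_nonneg)
qed

lemma unconditionally_stable_if_square_bound:
  fixes rnorm :: "'a::real_normed_vector \<Rightarrow> real"
  assumes "T > 0" and nonneg: "\<And>x. 0 \<le> rnorm x"
    and bound: "\<And>\<tau> N \<phi> u0 y n. \<lbrakk>\<tau> > 0; real N * \<tau> = T;
        scheme_solution \<tau> N (B \<tau>) (A \<tau>) \<phi> u0 y; n < N\<rbrakk> \<Longrightarrow>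
      (norm (y (Suc n)))\<^sup>2 \<le> (norm u0)\<^sup>2 + 1 / 2 * (\<Sum>k = 0..n. \<tau> * (rnorm (\<phi> k))\<^sup>2)"
  shows "unconditionally_stable rnorm T B A"
  unfolding unconditionally_stable_def
\<comment> \<open>At most \<open>N\<close> terms, each at most \<tau> M^2 with \<open>M\<close> the
  maximum of the source norms, sum to at most T M^2. The factor 1/2 in the bound then gives the
  constant \<open>sqrt (T / 2)\<close>.\<close>
proof (rule exI[of _ 1], intro exI[of _ "sqrt (T / 2)"] conjI allI impI)
  fix \<tau> :: real and N n :: nat and \<phi> u0 y
  assume \<tau>: "\<tau> > 0" "real N * \<tau> = T" and sol: "scheme_solution \<tau> N (B \<tau>) (A \<tau>) \<phi> u0 y"
    and "n < N"
  define M where "M = (MAX k\<in>{..n}. rnorm (\<phi> k))"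
  have le: "rnorm (\<phi> k) \<le> M" if "k \<le> n" for k
    unfolding M_def using that by (intro Max_ge) auto
  have "0 \<le> M" using nonneg[of "\<phi> 0"] le[of 0] by linarith
  have "(\<Sum>k = 0..n. \<tau> * (rnorm (\<phi> k))\<^sup>2) \<le> (\<Sum>k = 0..n. \<tau> * M\<^sup>2)"
    using \<tau> le nonneg by (intro sum_mono mult_left_mono power_mono) auto
  also have "\<dots> = real (Suc n) * \<tau> * M\<^sup>2" by simp
  also have "\<dots> \<le> real N * \<tau> * M\<^sup>2"
    using \<tau> \<open>n < N\<close> by (intro mult_right_mono) auto
  finally have "(norm (y (Suc n)))\<^sup>2 \<le> (norm u0)\<^sup>2 + T / 2 * M\<^sup>2"
    using bound[OF \<tau> sol \<open>n < N\<close>] \<tau>(2) by simp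
  \<comment> \<open>The cross term of the square is nonnegative, so a^2 + b^2 is at most (a +
    b)^2.\<close>
  also have "\<dots> \<le> (norm u0 + sqrt (T / 2) * M)\<^sup>2"
    using \<open>T > 0\<close> \<open>0 \<le> M\<close> by (simp add: power2_sum power_mult_distrib)
  finally have "norm (y (Suc n)) \<le> norm u0 + sqrt (T / 2) * M"
    by (rule power2_le_imp_le) (use \<open>T > 0\<close> \<open>0 \<le> M\<close> in auto)
  then show "norm (y (Suc n)) \<le> 1 * norm u0 + sqrt (T / 2) * (MAX k\<in>{..n}. rnorm (\<phi> k))"
    by (simp add: M_def)
qed (use \<open>T > 0\<close> in auto)

theorem theorem17:
  fixes D :: "'a::euclidean_space \<Rightarrow> 'a"
    and C0 :: "real \<Rightarrow> nat \<Rightarrow> 'a \<Rightarrow> 'a"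
    and \<sigma> \<kappa>1 M0 T :: real
  assumes "T > 0" and "\<kappa>1 > 0" and "M0 > 0"
    and "linear D" and "adjoint D = D"
    and "op_ge D (\<lambda>x. (\<kappa>1 / M0) *\<^sub>R x)"
    and "\<And>\<tau> N0 n. \<tau> > 0 \<Longrightarrow> real N0 * \<tau> = T \<Longrightarrow> n < N0 \<Longrightarrow> linear (C0 \<tau> n)"
    and "\<And>\<tau> N0 n. \<tau> > 0 \<Longrightarrow> real N0 * \<tau> = T \<Longrightarrow> n < N0 \<Longrightarrow>
           adjoint (C0 \<tau> n) = (\<lambda>x. - C0 \<tau> n x)"
    and "\<sigma> \<ge> 1 / 2"
  shows "unconditionally_stable (energy_norm (inv D)) T
           (weighted_op \<sigma> (conv_diff_op C0 D)) (conv_diff_op C0 D) \<and>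
         (\<forall>\<tau>>0. \<forall>N0::nat. real N0 * \<tau> = T \<longrightarrow>
            uniquely_solvable \<tau> N0
              (weighted_op \<sigma> (conv_diff_op C0 D) \<tau>) (conv_diff_op C0 D \<tau>) \<and>
            (\<forall>\<phi> u0 y.
               (scheme_solution \<tau> N0
                  (weighted_op \<sigma> (conv_diff_op C0 D) \<tau>) (conv_diff_op C0 D \<tau>) \<phi> u0 y \<longleftrightarrow>
                y 0 = u0 \<and>
                (\<forall>n<N0. (1 / \<tau>) *\<^sub>R (y (Suc n) - y n)
                   + conv_diff_op C0 D \<tau> n (\<sigma> *\<^sub>R y (Suc n) + (1 - \<sigma>) *\<^sub>R y n) = \<phi> n)) \<and>
               (scheme_solution \<tau> N0
                  (weighted_op \<sigma> (conv_diff_op C0 D) \<tau>) (conv_diff_op C0 D \<tau>) \<phi> u0 y \<longrightarrow>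
                (\<forall>n<N0. (norm (y (Suc n)))\<^sup>2 \<le>
                   (norm u0)\<^sup>2
                   + 1 / 2 * (\<Sum>k = 0..n. \<tau> * (energy_norm (inv D) (\<phi> k))\<^sup>2)))))"
proof -
  define A where "A = conv_diff_op C0 D"
  \<comment> \<open>Coercivity is turned into positive definiteness, the form in which the energy
    lemmas use it.\<close>
  have pos: "D x \<bullet> x > 0" if "x \<noteq> 0" for x
  proof -
    have "0 < \<kappa>1 / M0 * (x \<bullet> x)"
      using assms(2,3) that by simp
    also have "\<dots> \<le> D x \<bullet> x"
      using assms(6) by (simp add: op_ge_def)
    finally show ?thesis .
  qed
  have nonneg: "0 \<le> D x \<bullet> x" for x
    using pos[of x] assms(4) by (cases "x = 0") (auto simp: linear_0)
  have linA: "linear (A \<tau> n)" if "\<tau> > 0" "real N0 * \<tau> = T" "n < N0" for \<tau> N0 n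
    unfolding A_def conv_diff_op_def
    using linear_compose_add[OF assms(7)[OF that] assms(4)] .
  have innerA: "A \<tau> n x \<bullet> x = D x \<bullet> x" if "\<tau> > 0" "real N0 * \<tau> = T" "n < N0" for \<tau> N0 n x
    using skew_adjoint_inner_eq_0[OF assms(7)[OF that] assms(8)[OF that], of x]
    by (simp add: A_def conv_diff_op_def inner_add_left)
  have bound: "(norm (y (Suc n)))\<^sup>2
      \<le> (norm u0)\<^sup>2 + 1 / 2 * (\<Sum>k = 0..n. \<tau> * (energy_norm (inv D) (\<phi> k))\<^sup>2)"
    if "\<tau> > 0" "real N0 * \<tau> = T" "scheme_solution \<tau> N0 (weighted_op \<sigma> A \<tau>) (A \<tau>) \<phi> u0 y" "n < N0"
    for \<tau> N0 \<phi> u0 y n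
    using weighted_scheme_bound[OF assms(4,5) pos linA[OF that(1,2)] innerA[OF that(1,2)]
        that(1) assms(9) that(3,4)] .
  \<comment> \<open>Real \<open>sqrt\<close> is negative on negative arguments, so this rests on the
    positivity of \<open>inv D\<close>, inherited from \<open>D\<close> by substituting x = D(inv D
    x).\<close>
  have energy_nonneg: "0 \<le> energy_norm (inv D) x" for x
  proof -
    have "D (inv D x) = x"
      using linear_bij_if_definite[OF assms(4) pos] by (simp add: bij_is_surj surj_f_inv_f)
    then show ?thesis
      using nonneg[of "inv D x"] by (simp add: energy_norm_def inner_commute)
  qed
  have stable: "unconditionally_stable (energy_norm (inv D)) T (weighted_op \<sigma> A) A"
    using assms(1) energy_nonneg bound by (rule unconditionally_stable_if_square_bound)
  have solvable: "uniquely_solvable \<tau> N0 (weighted_op \<sigma> A \<tau>) (A \<tau>)"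
    if "\<tau> > 0" "real N0 * \<tau> = T" for \<tau> N0
    using that assms(9) nonneg
    by (intro uniquely_solvable_if_bij bij_weighted_op linA[OF that])
      (auto simp: innerA[OF that])
  have iff: "scheme_solution \<tau> N0 (weighted_op \<sigma> A \<tau>) (A \<tau>) \<phi> u0 y \<longleftrightarrow>
      y 0 = u0 \<and> (\<forall>n<N0. (1 / \<tau>) *\<^sub>R (y (Suc n) - y n)
        + A \<tau> n (\<sigma> *\<^sub>R y (Suc n) + (1 - \<sigma>) *\<^sub>R y n) = \<phi> n)"
    if "\<tau> > 0" "real N0 * \<tau> = T" for \<tau> N0 \<phi> u0 y
    using that linA[OF that] by (intro weighted_scheme_solution_iff) auto
  show ?thesis
    unfolding A_def[symmetric]
    using stable solvable iff bound by (intro conjI allI impI)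
qed

end
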